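(* If the Havel--Hakimi trajectory of a graphic sequence reaches a unit-band step, then every later step with positive pivot is also a unit-band step.
   Context: A finite sequence of nonnegative integers is graphic if it is the degree sequence of a finite simple graph. A Havel--Hakimi step on a nonincreasing graphic sequence $\mathbf d=(d_1,\ldots,d_t)$ with $d_1=D>0$ deletes $d_1=D$ (the pivot), subtracts one from each of $d_2,\ldots,d_{D+1}$ (the selected entries, positive by graphicality), and reorders in nonincreasing order. Repeating while the largest term is positive gives the trajectory. A step with pivot $D$ is a unit-band step if every selected degree (before subtraction) belongs to $\{D,D-1\}$. *)

theory Defs
  imports "Graph_Theory.Pair_Digraph"
begin

text \<open>
  A finite simple graph is a \<^locale>\<open>pair_graph\<close>: finite, loop-free, and with a symmetric set of
  arcs without parallel arcs. Each edge is a pair of opposite arcs, so the degree of a vertex is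
  its out-degree. Every finite graph is isomorphic to one whose vertices are natural numbers, so
  fixing the vertex type loses nothing. The list \<open>vs\<close> enumerates the vertices in the order
  in which their degrees are listed.
\<close>

definition graphic :: "nat list \<Rightarrow> bool" where
  "graphic d \<longleftrightarrow>
    (\<exists>(G :: nat pair_pre_digraph) vs. pair_graph G \<and> distinct vs \<and> set vs = pverts G \<and>
      d = map (out_degree (with_proj G)) vs)"

definition sort_desc :: "nat list \<Rightarrow> nat list" where
  "sort_desc d = rev (sort d)"

definition pivot :: "nat list \<Rightarrow> nat" where
  "pivot d = hd d"

definition selected :: "nat list \<Rightarrow> nat list" where
  "selected d = take (pivot d) (tl d)"

definition unselected :: "nat list \<Rightarrow> nat list" where
  "unselected d = drop (pivot d) (tl d)"

text \<open>
  On a nonincreasing graphic sequence the pivot is smaller than the length and the selected entries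
  are positive, so neither \<^const>\<open>take\<close> nor the subtraction on \<^typ>\<open>nat\<close> truncates.
\<close>

definition hh_step :: "nat list \<Rightarrow> nat list \<Rightarrow> bool" where
  "hh_step d d' \<longleftrightarrow> d \<noteq> [] \<and> pivot d > 0 \<and>
    d' = sort_desc (map (\<lambda>x. x - 1) (selected d) @ unselected d)"

definition hh_reaches :: "nat list \<Rightarrow> nat list \<Rightarrow> bool" where
  "hh_reaches d e \<longleftrightarrow> hh_step\<^sup>*\<^sup>* (sort_desc d) e"

text \<open>A step is determined by the sequence it is applied to.\<close>

definition unit_band_step :: "nat list \<Rightarrow> bool" where
  "unit_band_step d \<longleftrightarrow> d \<noteq> [] \<and> pivot d > 0 \<and>
    set (selected d) \<subseteq> {pivot d, pivot d - 1}"

end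

theory Submission
  imports Defs
begin

text \<open>
  Let a unit-band step have pivot \<open>D\<close> and let \<open>p\<close> be the pivot of the next list, so \<open>p \<le> D\<close>.
  The reduced entries are at least \<open>D - 2\<close>. If \<open>p < D\<close>, they already supply \<open>p + 1\<close> entries that
  are at least \<open>p - 1\<close>. If \<open>p = D\<close>, an unselected entry equals \<open>D\<close>, so every selected entry was
  \<open>D\<close> and became \<open>D - 1\<close>; with that unselected entry there are \<open>D + 1\<close> entries that are at least
  \<open>p - 1\<close>. Either way the \<open>p + 1\<close> largest entries of the next list lie in \<open>{p - 1, p}\<close>.
\<close>

lemma sorted_wrt_sort_desc: "sorted_wrt (\<ge>) (sort_desc xs)"
  by (simp add: sort_desc_def sorted_wrt_rev)

lemma mset_sort_desc [simp]: "mset (sort_desc xs) = mset xs"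
  by (simp add: sort_desc_def)

lemma sorted_wrt_le_hd:
  fixes xs :: "nat list"
  shows "sorted_wrt (\<ge>) xs \<Longrightarrow> x \<in> set xs \<Longrightarrow> x \<le> hd xs"
  by (cases xs) auto

text \<open>In a nonincreasing list the entries that are at least \<open>c\<close> form a prefix, so
  counting them is enough. The \<open>min\<close> covers lists shorter than
  \<open>n\<close>.\<close>

lemma take_ge_if_filter_ge:
  fixes xs :: "nat list"
  assumes "sorted_wrt (\<ge>) xs" "min n (length xs) \<le> length (filter ((\<le>) c) xs)"
    and "x \<in> set (take n xs)"
  shows "c \<le> x"
  using assms
proof (induction xs arbitrary: n)
  case (Cons y ys)
  show ?case
  proof (cases "c \<le> y")
    case True
    with Cons show ?thesis by (cases n) auto
  next
    case False
    with Cons.prems(1) have "filter ((\<le>) c) (y # ys) = []"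
      by (auto simp: filter_empty_conv)
    with Cons.prems(2) have "n = 0" by (simp only: list.size)
    with Cons.prems(3) show ?thesis by simp
  qed
qed simp

text \<open>This turns the band condition into a count, which reordering preserves. The count is
  \<open>Suc (pivot f)\<close> because the head of \<open>f\<close> is counted along with the
  selected entries.\<close>

lemma unit_band_step_if_many_ge:
  assumes "sorted_wrt (\<ge>) f" "f \<noteq> []" "pivot f > 0"
    and "min (Suc (pivot f)) (length f) \<le> length (filter ((\<le>) (pivot f - 1)) f)"
  shows "unit_band_step f"
  unfolding unit_band_step_def
proof (intro conjI subsetI)
  fix x assume "x \<in> set (selected f)"
  then have x: "x \<in> set (take (Suc (pivot f)) f)"
    using \<open>f \<noteq> []\<close> by (cases f) (auto simp: selected_def)
  then have "x \<le> pivot f"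
    using sorted_wrt_le_hd[OF assms(1)] by (auto simp: pivot_def dest: in_set_takeD)
  with take_ge_if_filter_ge[OF assms(1,4) x] show "x \<in> {pivot f, pivot f - 1}"
    by auto
qed (use assms in auto)

lemma unit_band_step_hh_step:
  assumes sorted: "sorted_wrt (\<ge>) e" and band: "unit_band_step e"
    and step: "hh_step e f" and f: "f \<noteq> []" "pivot f > 0"
  shows "unit_band_step f"
proof -
  define D where "D = pivot e"
  define R where "R = map (\<lambda>x. x - 1) (selected e)"
  define U where "U = unselected e"
  have f_eq: "f = sort_desc (R @ U)"
    using step by (simp add: hh_step_def R_def U_def)
  have sorted_f: "sorted_wrt (\<ge>) f"
    by (simp add: f_eq sorted_wrt_sort_desc)
  have mset_f: "mset f = mset (R @ U)"
    by (simp add: f_eq)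
  have set_f: "set f = set R \<union> set U"
    using mset_eq_setD[OF mset_f] by simp
  have len_f: "length f = length R + length U"
    using mset_eq_length[OF mset_f] by simp
  have count: "length (filter P f) = length (filter P R) + length (filter P U)" for P
    using arg_cong[OF mset_f, of "\<lambda>M. size (filter_mset P M)"]
    by (simp flip: mset_filter)
  have e: "e = D # selected e @ U" "D > 0"
    using band by (cases e; simp add: unit_band_step_def D_def U_def selected_def
        unselected_def pivot_def)+
  have sel: "set (selected e) \<subseteq> {D, D - 1}"
    using band by (simp add: unit_band_step_def D_def)
  \<comment> \<open>\<open>take\<close> can fall short of \<open>D\<close> entries only if
    \<open>drop\<close> leaves nothing.\<close>
  have len_R: "U = [] \<or> length R = D"
    by (auto simp: R_def U_def selected_def unselected_def D_def)
  have sel_ge_U: "u \<le> s" if "s \<in> set (selected e)" "u \<in> set U" for s u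
    using sorted that by (subst (asm) e(1)) (auto simp: sorted_wrt_append)
  have U_le: "u \<le> D" if "u \<in> set U" for u
    using sorted that by (subst (asm) e(1)) auto
  have R_bounds: "D - 2 \<le> r" "r \<le> D - 1" if "r \<in> set R" for r
    using that sel by (auto simp: R_def)
  have pivot_in: "pivot f \<in> set R \<union> set U"
    using f by (simp add: pivot_def flip: set_f)
  \<comment> \<open>Entries of \<open>R\<close> are at most \<open>D - 1\<close>, so a pivot equal
    to \<open>D\<close> must come from \<open>U\<close>.\<close>
  consider "pivot f < D" | "D \<in> set U" "pivot f = D"
    using pivot_in R_bounds U_le \<open>D > 0\<close> by fastforce
  then have "min (Suc (pivot f)) (length f) \<le> length (filter ((\<le>) (pivot f - 1)) f)"
  proof cases
    case 1
    then have "filter ((\<le>) (pivot f - 1)) R = R"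
      using R_bounds(1) by (fastforce simp: filter_id_conv)
    \<comment> \<open>If \<open>U\<close> is empty, every entry of \<open>f\<close> counts;
      otherwise \<open>R\<close> alone supplies \<open>D \<ge> Suc (pivot f)\<close>
      entries.\<close>
    with 1 len_R show ?thesis
      by (auto simp: count len_f)
  next
    case 2
    have "s = D" if "s \<in> set (selected e)" for s
      using that 2 sel sel_ge_U[OF that, of D] by auto
    then have "filter ((\<le>) (pivot f - 1)) R = R"
      using 2 by (auto simp: filter_id_conv R_def)
    moreover have "filter ((\<le>) (pivot f - 1)) U \<noteq> []"
      using 2 by (auto simp: filter_empty_conv intro!: bexI[of _ D])
    moreover have "length R = D"
      using 2 len_R by auto
    ultimately show ?thesis
      using 2 by (cases "filter ((\<le>) (pivot f - 1)) U") (auto simp: count)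
  qed
  with sorted_f f show ?thesis
    by (intro unit_band_step_if_many_ge)
qed

lemma hh_step_sorted: "hh_step e f \<Longrightarrow> sorted_wrt (\<ge>) f"
  by (auto simp: hh_step_def sorted_wrt_sort_desc)

lemma hh_reaches_sorted: "hh_reaches d e \<Longrightarrow> sorted_wrt (\<ge>) e"
  unfolding hh_reaches_def
  by (erule rtranclp.cases) (auto simp: sorted_wrt_sort_desc hh_step_sorted)

theorem lemma10:
  fixes d e f :: "nat list"
  assumes "graphic d"
    and "hh_reaches d e" and "unit_band_step e"
    and "hh_step\<^sup>+\<^sup>+ e f" and "f \<noteq> []" and "pivot f > 0"
  shows "unit_band_step f"
  using assms(4,5,6)
proof (induction rule: tranclp_induct)
  case (base f)
  then show ?case
    using unit_band_step_hh_step[OF hh_reaches_sorted[OF assms(2)] assms(3)] by blast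
next
  case (step f g)
  have "unit_band_step f"
    using step.IH step.hyps(2) by (simp add: hh_step_def)
  \<comment> \<open>At least one step leads from \<open>e\<close> to \<open>f\<close>, and the last
    of them sorted its result.\<close>
  moreover have "sorted_wrt (\<ge>) f"
    using step.hyps(1) by (cases rule: tranclp.cases) (auto intro: hh_step_sorted)
  ultimately show ?case
    using unit_band_step_hh_step step by blast
qed

end
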